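(* Let $n$ and $w$ be positive integers. There is no $\mathrm{CGW}(n,w;6)$ when $n$ is odd and $w \equiv 2 \pmod 4$.
   Context: For a positive integer $k$, let $\zeta_k = e^{2\pi\sqrt{-1}/k}$ and $\mathcal{U}_k = \{0\} \cup \{\zeta_k^j : 0 \le j \le k-1\}$. A $\mathrm{CGW}(n,w;k)$ (complex generalized weighing matrix of order $n$ and weight $w$) is an $n \times n$ matrix $W$ with entries in $\mathcal{U}_k$ such that $WW^{*} = wI_n$, where $W^*$ is the complex conjugate transpose. *)

theory Defs
  imports
    Complex_Main
    "HOL-Number_Theory.Cong"
    "Jordan_Normal_Form.Schur_Decomposition"
begin

definition zeta :: "nat \<Rightarrow> complex" where
  "zeta k = exp (2 * of_real pi * \<i> / of_nat k)"

definition roots_with_zero :: "nat \<Rightarrow> complex set" where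
  "roots_with_zero k = {0} \<union> {zeta k ^ j | j. j < k}"

(* Only meant for k > 0. mat_adjoint is the conjugate transpose; its definition in
   Schur_Decomposition has the right dimensions for square matrices, the only ones used
   here (see mat_adjoint_square). *)
definition CGW :: "nat \<Rightarrow> nat \<Rightarrow> nat \<Rightarrow> complex mat set" where
  "CGW n w k = {W \<in> carrier_mat n n.
     elements_mat W \<subseteq> roots_with_zero k \<and>
     W * mat_adjoint W = of_nat w \<cdot>\<^sub>m 1\<^sub>m n}"

lemma mat_adjoint_square:
  fixes W :: "complex mat"
  assumes "W \<in> carrier_mat n n"
  shows "mat_adjoint W = map_mat cnj (transpose_mat W)"
  using assms by (intro eq_matI) (auto simp: mat_adjoint_def mat_of_rows_def)

end

theory Submission
  imports Defs
begin

text \<open>The determinant \<open>d\<close> of such a matrix is an Eisenstein integer \<open>a + b \<zeta>\<^sub>6\<close>, so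
  \<open>w\<^sup>n = d d\<^sup>* = a\<^sup>2 + a b + b\<^sup>2\<close>. As \<open>2\<close> is inert in the Eisenstein integers, the exponent of
  \<open>2\<close> in the right-hand side is even, whereas in \<open>w\<^sup>n\<close> it is \<open>n\<close>.\<close>

text \<open>The usual basis of this ring is 1 and a primitive cube root of unity. As
  \<open>zeta 6 - 1\<close> is such a root, the basis 1, \<open>zeta 6\<close> spans the same ring
  and contains the matrix entries as powers of a basis element.\<close>

definition eisenstein_ints :: "complex set" where
  "eisenstein_ints = {of_int a + of_int b * zeta 6 | a b. True}"

lemma zeta_6: "zeta 6 = Complex (1 / 2) (sqrt 3 / 2)"
proof -
  have "zeta 6 = cis (pi / 3)"
    unfolding zeta_def cis_conv_exp by (simp add: field_simps)
  then show ?thesis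
    by (simp add: complex_eq_iff cos_60 sin_60)
qed

text \<open>The minimal polynomial \<open>x^2 - x + 1\<close> of \<open>zeta 6\<close>, in the form
  that reduces products back to the basis 1, \<open>zeta 6\<close>.\<close>

lemma zeta_6_mult_self: "zeta 6 * zeta 6 = zeta 6 - 1"
  by (simp add: zeta_6 complex_eq_iff)

lemma eisenstein_ints_of_int: "of_int a \<in> eisenstein_ints"
proof -
  have "of_int a = of_int a + of_int 0 * zeta 6"
    by simp
  then show ?thesis
    unfolding eisenstein_ints_def by blast
qed

lemma eisenstein_ints_0: "0 \<in> eisenstein_ints"
  using eisenstein_ints_of_int[of 0] by simp

lemma eisenstein_ints_1: "1 \<in> eisenstein_ints"
  using eisenstein_ints_of_int[of 1] by simp

lemma eisenstein_ints_zeta_6: "zeta 6 \<in> eisenstein_ints"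
proof -
  have "zeta 6 = of_int 0 + of_int 1 * zeta 6"
    by simp
  then show ?thesis
    unfolding eisenstein_ints_def by blast
qed

lemma eisenstein_ints_add:
  assumes "x \<in> eisenstein_ints" "y \<in> eisenstein_ints"
  shows "x + y \<in> eisenstein_ints"
proof -
  obtain a b c d where "x = of_int a + of_int b * zeta 6" "y = of_int c + of_int d * zeta 6"
    using assms unfolding eisenstein_ints_def by blast
  then have "x + y = of_int (a + c) + of_int (b + d) * zeta 6"
    by (simp add: algebra_simps)
  then show ?thesis
    unfolding eisenstein_ints_def by blast
qed

lemma eisenstein_ints_mult:
  assumes "x \<in> eisenstein_ints" "y \<in> eisenstein_ints"
  shows "x * y \<in> eisenstein_ints"
proof -
  obtain a b c d where xy: "x = of_int a + of_int b * zeta 6" "y = of_int c + of_int d * zeta 6"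
    using assms unfolding eisenstein_ints_def by blast
  have "x * y = of_int a * of_int c + (of_int a * of_int d + of_int b * of_int c) * zeta 6
      + of_int b * of_int d * (zeta 6 * zeta 6)"
    unfolding xy by (simp add: algebra_simps)
  also have "\<dots> = of_int (a * c - b * d) + of_int (a * d + b * c + b * d) * zeta 6"
    unfolding zeta_6_mult_self by (simp add: algebra_simps)
  finally show ?thesis
    unfolding eisenstein_ints_def by blast
qed

lemma eisenstein_ints_power: "x \<in> eisenstein_ints \<Longrightarrow> x ^ k \<in> eisenstein_ints"
  by (induction k) (simp_all add: eisenstein_ints_1 eisenstein_ints_mult)

lemma eisenstein_ints_sum:
  "(\<And>i. i \<in> A \<Longrightarrow> f i \<in> eisenstein_ints) \<Longrightarrow> sum f A \<in> eisenstein_ints"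
  by (induction A rule: infinite_finite_induct)
    (simp_all add: eisenstein_ints_0 eisenstein_ints_add)

lemma eisenstein_ints_prod:
  "(\<And>i. i \<in> A \<Longrightarrow> f i \<in> eisenstein_ints) \<Longrightarrow> prod f A \<in> eisenstein_ints"
  by (induction A rule: infinite_finite_induct)
    (simp_all add: eisenstein_ints_1 eisenstein_ints_mult)

lemma roots_with_zero_6_subset: "roots_with_zero 6 \<subseteq> eisenstein_ints"
  unfolding roots_with_zero_def
  by (auto simp: eisenstein_ints_0 intro: eisenstein_ints_power eisenstein_ints_zeta_6)

text \<open>By the Leibniz formula, the determinant is a sum of signed products of entries, and the
  Eisenstein integers are closed under sums and products.\<close>

lemma det_in_eisenstein_ints:
  assumes W: "W \<in> carrier_mat n n" and el: "elements_mat W \<subseteq> eisenstein_ints"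
  shows "det W \<in> eisenstein_ints"
  unfolding det_def'[OF W]
proof (intro eisenstein_ints_sum eisenstein_ints_mult eisenstein_ints_prod)
  fix p :: "nat \<Rightarrow> nat"
  show "of_int (sign p) \<in> eisenstein_ints"
    by (rule eisenstein_ints_of_int)
  fix i assume "p \<in> {p. p permutes {0..<n}}" "i \<in> {0..<n}"
  then have "i < n" "p i < n"
    using permutes_in_image[of p "{0..<n}" i] by auto
  then show "W $$ (i, p i) \<in> eisenstein_ints"
    using W el by auto
qed

text \<open>Both the trace and the norm of \<open>zeta 6\<close> are 1, which gives the cross term
  \<open>a * b\<close> and the last term their coefficients.\<close>

lemma eisenstein_ints_norm:
  assumes "x \<in> eisenstein_ints"
  obtains a b :: int where "x * cnj x = of_int (a\<^sup>2 + a * b + b\<^sup>2)"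
proof -
  obtain a b where x: "x = of_int a + of_int b * zeta 6"
    using assms unfolding eisenstein_ints_def by blast
  have "x * cnj x = of_int (a\<^sup>2 + a * b + b\<^sup>2)"
    unfolding x zeta_6 by (simp add: complex_eq_iff power2_eq_square algebra_simps)
  then show ?thesis
    by (rule that)
qed

lemma det_mult_cnj_det:
  assumes "W \<in> CGW n w k"
  shows "det W * cnj (det W) = of_nat (w ^ n)"
proof -
  have W: "W \<in> carrier_mat n n" and eq: "W * mat_adjoint W = of_nat w \<cdot>\<^sub>m 1\<^sub>m n"
    using assms unfolding CGW_def by auto
  \<comment> \<open>As a ring homomorphism, conjugation commutes with \<open>det\<close> when
    applied entrywise.\<close>
  interpret cnj: comm_ring_hom cnj
    by unfold_locales auto
  have "det (mat_adjoint W) = cnj (det W)"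
    using W by (simp add: mat_adjoint_square det_transpose)
  then have "det W * cnj (det W) = det (W * mat_adjoint W)"
    using W by (simp add: mat_adjoint_square det_mult)
  also have "\<dots> = of_nat (w ^ n)"
    by (simp add: eq)
  finally show ?thesis .
qed

text \<open>Descent on the power of 2: an even value of the form forces \<open>a\<close> and
  \<open>b\<close> to be even, and halving both divides the value by 4, that is, lowers
  \<open>k\<close> by one. At \<open>k = 0\<close> the odd number \<open>m\<close> would become
  even.\<close>

lemma loeschian_ne_odd_power_of_2_times_odd:
  fixes a b m :: int
  assumes "odd m"
  shows "a\<^sup>2 + a * b + b\<^sup>2 \<noteq> 2 ^ (2 * k + 1) * m"
proof (induction k arbitrary: a b)
  case (0 a b)
  show ?case
  proof
    assume eq: "a\<^sup>2 + a * b + b\<^sup>2 = 2 ^ (2 * 0 + 1) * m"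
    then have "even (a\<^sup>2 + a * b + b\<^sup>2)"
      by simp
    \<comment> \<open>Modulo 2 the form is 1 at (1,0), (0,1) and (1,1); this is where 2 being inert
      enters.\<close>
    then have "even a" "even b"
      by auto
    then obtain c d where "a = 2 * c" "b = 2 * d"
      by (auto elim!: evenE)
    with eq have "m = 2 * (c\<^sup>2 + c * d + d\<^sup>2)"
      by (simp add: power2_eq_square)
    with assms show False
      by simp
  qed
next
  case (Suc k a b)
  show ?case
  proof
    assume eq: "a\<^sup>2 + a * b + b\<^sup>2 = 2 ^ (2 * Suc k + 1) * m"
    then have "even (a\<^sup>2 + a * b + b\<^sup>2)"
      by simp
    then have "even a" "even b"
      by auto
    then obtain c d where "a = 2 * c" "b = 2 * d"
      by (auto elim!: evenE)
    \<comment> \<open>A factor 4 cancels on both sides, so the induction hypothesis applies to the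
      halved pair.\<close>
    with eq have "c\<^sup>2 + c * d + d\<^sup>2 = 2 ^ (2 * k + 1) * m"
      by (simp add: power2_eq_square)
    with Suc show False
      by blast
  qed
qed

theorem proposition2p7:
  fixes n w :: nat
  assumes "n > 0" and "w > 0"
    and "odd n" and "[w = 2] (mod 4)"
  shows "\<not> (\<exists>W. W \<in> CGW n w 6)"
proof
  assume "\<exists>W. W \<in> CGW n w 6"
  then obtain W where W: "W \<in> CGW n w 6" ..
  then have "det W \<in> eisenstein_ints"
    using roots_with_zero_6_subset unfolding CGW_def by (intro det_in_eisenstein_ints) auto
  then obtain a b :: int where "det W * cnj (det W) = of_int (a\<^sup>2 + a * b + b\<^sup>2)"
    by (rule eisenstein_ints_norm)
  then have "of_int (a\<^sup>2 + a * b + b\<^sup>2) = (of_int (int (w ^ n)) :: complex)"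
    using det_mult_cnj_det[OF W] by simp
  then have norm: "a\<^sup>2 + a * b + b\<^sup>2 = int (w ^ n)"
    using of_int_eq_iff by blast
  \<comment> \<open>The congruence says that 2 divides \<open>w\<close> exactly once, so 2 divides
    \<open>w ^ n\<close> exactly \<open>n\<close> times.\<close>
  obtain u where u: "w = 2 * u" "odd u"
  proof
    show "w = 2 * (w div 2)" "odd (w div 2)"
      using assms(4) unfolding cong_def by presburger+
  qed
  obtain k where k: "n = 2 * k + 1"
    using \<open>odd n\<close> by (rule oddE)
  have "a\<^sup>2 + a * b + b\<^sup>2 = 2 ^ (2 * k + 1) * int u ^ n"
    unfolding norm u(1) by (simp add: k power_mult_distrib)
  moreover have "odd (int u ^ n)"
    using u(2) by simp
  ultimately show False
    using loeschian_ne_odd_power_of_2_times_odd by blast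
qed

end
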